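(* In the $\mathsf{UORA}$ policy (with parameters chosen as specified in the context), the queues $Q_n^{(c)}(t)$, $D_n^{(c)}(t)$ and $Z_c(t)$ are deterministically bounded by $$Q_n^{(c)}(t)\le Q_{\max}^{(c)},\qquad D_n^{(c)}(t)\le D_{\max}^{(c)},\qquad Z_c(t)\le Z_{\max}^{(c)}$$ for all $t$, $c$, and $n\ne d_c$, where $Q_{\max}^{(c)}\triangleq V\theta_c+2d_{\max}$, $D_{\max}^{(c)}\triangleq V\theta_c+d_{\max}$, and $$Z_{\max}^{(c)}\triangleq Q+\frac1w\log\left(\frac{V\theta_c+2d_{\max}}{w}\right)+\mu_{\max}^{\text{in}}.$$
   Context: Network model. Finite node set $\mathcal N$, set $\mathcal L$ of directed links, finite set $\mathcal C$ of traffic classes; class $c$ has destination $d_c\in\mathcal N$. Slots $t=0,1,2,\dots$. Exogenous class $c$ arrivals at node $n$ in slot $t$: $A_n^{(c)}(t)\in\{0,\dots,A_{\max}\}$, $A_{d_c}^{(c)}(t)=0$, independent across $c$ and $n\neq d_c$, i.i.d. over slots with mean $\lambda_n^{(c)}$. Link $(n,m)$ has capacity $\mu_{\max}^{nm}$; allocated service rates satisfy $\mu_{nm}^{(c)}(t)\ge0$ and $\sum_c\mu_{nm}^{(c)}(t)\le\mu_{\max}^{nm}$. The class $c$ backlog $Q_n^{(c)}(t)\ge0$ at node $n\ne d_c$ satisfies $Q_n^{(c)}(0)=0$ and $$Q_n^{(c)}(t+1)\le\Big[\big(Q_n^{(c)}(t)-\sum_b\mu_{nb}^{(c)}(t)\big)^+-d_n^{(c)}(t)\Big]^++A_n^{(c)}(t)+\sum_a\mu_{an}^{(c)}(t),\qquad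 (x)^+=\max(x,0),$$ where $d_n^{(c)}(t)\in[0,d_{\max}]$ is the allocated drop rate. The packets actually dropped are $\widetilde d_n^{(c)}(t)=\min\big[(Q_n^{(c)}(t)-\sum_b\mu_{nb}^{(c)}(t))^+,\,d_n^{(c)}(t)\big]$. Drop queues: $D_n^{(c)}(0)=V\theta_c$, $D_n^{(c)}(t+1)=[D_n^{(c)}(t)-\varphi_n^{(c)}(t)]^++\widetilde d_n^{(c)}(t)$, $\varphi_n^{(c)}(t)\in[0,d_{\max}]$. Virtual queues: $Z_c(0)=0$, $Z_c(t+1)=[Z_c(t)-\nu_c(t)]^++\sum_a\widetilde\mu_{ad_c}^{(c)}(t)$, where $\widetilde\mu_{ad_c}^{(c)}(t)=\min[Q_a^{(c)}(t),\mu_{ad_c}^{(c)}(t)]$ is the class $c$ data received by $d_c$ over link $(a,d_c)$. Let $\mu_{\max}^{\text{in}}=\max_n\sum_{a:(a,n)\in\mathcal L}\mu_{\max}^{an}$. Standing assumption: $d_{\max}\ge A_{\max}+\mu_{\max}^{\text{in}}$. Utilities: each $g_c:[0,\infty)\to\mathbb R$ is concave, increasing, continuously differentiable with bounded derivative; $h_c(x)=g_c(x)-\theta_cx$. Parameters. $\epsilon>0$; $\nu_{\max}\ge\max_cr_c^*+\epsilon/2$, where $(r_c^* )$ maximizes $\sum_cg_c(r_c)$ over nonnegative $(r_c)$ for which there are $f_{ab}^{(c)}\ge0$, $q_n^{(c)}\ge0$ with $\lambda_n^{(c)}+\sum_af_{an}^{(c)}=q_n^{(c)}+\sum_bf_{nb}^{(c)}$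 ($n\ne d_c$), $\sum_cf_{ab}^{(c)}\le\mu_{\max}^{ab}$, and $r_c\le\sum_af_{ad_c}^{(c)}=\sum_n\lambda_n^{(c)}-\sum_nq_n^{(c)}$; $\delta_{\max}=\max[\nu_{\max},\mu_{\max}^{\text{in}}]$; $w=\frac{\epsilon}{\delta_{\max}^2}e^{-\epsilon/\delta_{\max}}$; $Q\ge\nu_{\max}$; $\theta_c>0$ with $h_c'(x)\le0$ for all $x\ge\epsilon$; $V>0$ with $V\theta_c+2d_{\max}\ge w$ for all $c$. $\mathsf{UORA}$ policy, in every slot $t$. For each class $c$ define $Q_{d_c}^{(c)}(t)=w\,e^{w(Z_c(t)-Q)}$ if $Z_c(t)\ge Q$ and $Q_{d_c}^{(c)}(t)=-w\,e^{w(Q-Z_c(t))}$ if $Z_c(t)<Q$ (a function of the virtual queue, not real data). (1) Packet dropping: $d_n^{(c)}(t)=d_{\max}$ if $Q_n^{(c)}(t)>D_n^{(c)}(t)$ and $0$ otherwise; $\varphi_n^{(c)}(t)=d_{\max}$ if $D_n^{(c)}(t)>V\theta_c$ and $0$ otherwise. (2) Backpressure routing: for each link $l=(n,m)$ with set $\mathcal C_l$ of classes having access to $l$, compute $W_l^{(c)}(t)=Q_n^{(c)}(t)-Q_m^{(c)}(t)$ for $c\in\mathcal C_l$ (where, when $m=d_c$, $Q_m^{(c)}(t)=Q_{d_c}^{(c)}(t)$ equals $w\,e^{w(Z_c(t)-Q)}$ if $Z_c(t)\ge Q$ and $-w\,e^{w(Q-Z_c(t))}$ if $Z_c(t)<Q$);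 let $c_l^*(t)$ maximize it over $c\in\mathcal C_l$. Set $\mu_{nm}^{(c_l^*(t))}(t)=\mu_{\max}^{nm}$ if $\max_{c\in\mathcal C_l}W_l^{(c)}(t)>0$ and $0$ otherwise; set $\mu_{nm}^{(c)}(t)=0$ for all other classes. Class $c$ has no access to links leaving $d_c$. (3) Receiver-based flow control: $\nu_c(t)$ maximizes $Vh_c(\nu)+\nu\,Q_{d_c}^{(c)}(t)$ over $0\le\nu\le\nu_{\max}$. (4) Update the queues. *)

theory Defs
  imports "HOL-Probability.Probability"
begin

locale network =
  fixes N :: "'n set" and L :: "('n \<times> 'n) set" and C :: "'c set"
    and dest :: "'c \<Rightarrow> 'n" and cap :: "'n \<Rightarrow> 'n \<Rightarrow> real"
  assumes finite_N: "finite N"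
    and L_sub: "L \<subseteq> N \<times> N"
    and finite_C: "finite C"
    and dest_N: "c \<in> C \<Longrightarrow> dest c \<in> N"
    and cap_nonneg: "(n, m) \<in> L \<Longrightarrow> 0 \<le> cap n m"
begin

definition in_nbrs :: "'n \<Rightarrow> 'n set" where
  "in_nbrs n = {a. (a, n) \<in> L}"

definition out_nbrs :: "'n \<Rightarrow> 'n set" where
  "out_nbrs n = {b. (n, b) \<in> L}"

definition mu_max_in :: real where
  "mu_max_in = Max ((\<lambda>n. \<Sum>a\<in>in_nbrs n. cap a n) ` N)"

definition delta_max :: "real \<Rightarrow> real" where
  "delta_max \<nu>_max = max \<nu>_max mu_max_in"

definition w_param :: "real \<Rightarrow> real \<Rightarrow> real" where
  "w_param \<epsilon> \<nu>_max = \<epsilon> / (delta_max \<nu>_max)\<^sup>2 * exp (- \<epsilon> / delta_max \<nu>_max)"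

text \<open>Throughput vectors supported by some flow \<open>f\<close> with drop rates \<open>q\<close>, for arrival rates
  \<open>lam\<close>. Drop rates exist only at nodes other than the destination, and no class \<open>c\<close> traffic
  arrives at \<open>dest c\<close>, so both network-wide sums run over \<open>N - {dest c}\<close>.\<close>

definition feasible_rates :: "('n \<Rightarrow> 'c \<Rightarrow> real) \<Rightarrow> ('c \<Rightarrow> real) set" where
  "feasible_rates lam = {r. (\<forall>c\<in>C. 0 \<le> r c) \<and>
     (\<exists>f q.
        (\<forall>c\<in>C. \<forall>(a, b)\<in>L. 0 \<le> f a b c) \<and>
        (\<forall>c\<in>C. \<forall>n\<in>N - {dest c}. 0 \<le> q n c) \<and>
        (\<forall>c\<in>C. \<forall>n\<in>N - {dest c}.
           lam n c + (\<Sum>a\<in>in_nbrs n. f a n c) = q n c + (\<Sum>b\<in>out_nbrs n. f n b c)) \<and>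
        (\<forall>(a, b)\<in>L. (\<Sum>c\<in>C. f a b c) \<le> cap a b) \<and>
        (\<forall>c\<in>C. r c \<le> (\<Sum>a\<in>in_nbrs (dest c). f a (dest c) c)) \<and>
        (\<forall>c\<in>C. (\<Sum>a\<in>in_nbrs (dest c). f a (dest c) c) =
           (\<Sum>n\<in>N - {dest c}. lam n c) - (\<Sum>n\<in>N - {dest c}. q n c)))}"

end

locale stochastic_network = network N L C dest cap + prob_space M
  for N :: "'n set" and L :: "('n \<times> 'n) set" and C :: "'c set"
    and dest :: "'c \<Rightarrow> 'n" and cap :: "'n \<Rightarrow> 'n \<Rightarrow> real"
    and M :: "'w measure" +
  fixes A :: "'n \<Rightarrow> 'c \<Rightarrow> nat \<Rightarrow> 'w \<Rightarrow> nat" and A_max :: nat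
    and lam :: "'n \<Rightarrow> 'c \<Rightarrow> real"
  assumes A_bound: "\<lbrakk>n \<in> N; c \<in> C; \<omega> \<in> space M\<rbrakk> \<Longrightarrow> A n c t \<omega> \<le> A_max"
    and A_dest: "\<lbrakk>c \<in> C; \<omega> \<in> space M\<rbrakk> \<Longrightarrow> A (dest c) c t \<omega> = 0"
    and A_indep: "indep_vars (\<lambda>_. count_space UNIV) (\<lambda>(n, c, t). A n c t)
          {(n, c, t). n \<in> N \<and> c \<in> C \<and> n \<noteq> dest c}"
    and A_ident: "\<lbrakk>n \<in> N; c \<in> C; n \<noteq> dest c\<rbrakk> \<Longrightarrow>
          distr M (count_space UNIV) (A n c t) = distr M (count_space UNIV) (A n c 0)"
    and A_mean: "\<lbrakk>n \<in> N; c \<in> C\<rbrakk> \<Longrightarrow> expectation (\<lambda>\<omega>. real (A n c t \<omega>)) = lam n c"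

text \<open>All processes are functions of the slot \<open>t\<close> and the sample point \<open>\<omega>\<close>, and the queue
  dynamics hold on every sample path. Here \<open>d\<close> and \<open>\<phi>\<close> are the allocated drop rate and the
  service rate of the drop queue, \<open>\<nu>\<close> is the service rate of the virtual queue \<open>Z\<close>. The values
  \<open>Q (dest c) c\<close> and \<open>D (dest c) c\<close> carry no meaning and are unconstrained; in particular a
  possible self-loop at \<open>dest c\<close> delivers no class \<open>c\<close> data.\<close>

locale queueing_network = stochastic_network N L C dest cap M A A_max lam
  for N :: "'n set" and L :: "('n \<times> 'n) set" and C :: "'c set"
    and dest :: "'c \<Rightarrow> 'n" and cap :: "'n \<Rightarrow> 'n \<Rightarrow> real"
    and M :: "'w measure" and A :: "'n \<Rightarrow> 'c \<Rightarrow> nat \<Rightarrow> 'w \<Rightarrow> nat" and A_max :: nat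
    and lam :: "'n \<Rightarrow> 'c \<Rightarrow> real" +
  fixes d_max V :: real and \<theta> :: "'c \<Rightarrow> real"
    and \<mu> :: "'n \<Rightarrow> 'n \<Rightarrow> 'c \<Rightarrow> nat \<Rightarrow> 'w \<Rightarrow> real"
    and d \<phi> :: "'n \<Rightarrow> 'c \<Rightarrow> nat \<Rightarrow> 'w \<Rightarrow> real"
    and \<nu> :: "'c \<Rightarrow> nat \<Rightarrow> 'w \<Rightarrow> real"
    and Q D :: "'n \<Rightarrow> 'c \<Rightarrow> nat \<Rightarrow> 'w \<Rightarrow> real"
    and Z :: "'c \<Rightarrow> nat \<Rightarrow> 'w \<Rightarrow> real"
  assumes d_max_ge: "real A_max + mu_max_in \<le> d_max"
    and mu_nonneg: "\<lbrakk>(n, m) \<in> L; c \<in> C; \<omega> \<in> space M\<rbrakk> \<Longrightarrow> 0 \<le> \<mu> n m c t \<omega>"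
    and mu_cap: "\<lbrakk>(n, m) \<in> L; \<omega> \<in> space M\<rbrakk> \<Longrightarrow> (\<Sum>c\<in>C. \<mu> n m c t \<omega>) \<le> cap n m"
    and d_range: "\<lbrakk>n \<in> N; c \<in> C; n \<noteq> dest c; \<omega> \<in> space M\<rbrakk> \<Longrightarrow> d n c t \<omega> \<in> {0..d_max}"
    and phi_range: "\<lbrakk>n \<in> N; c \<in> C; n \<noteq> dest c; \<omega> \<in> space M\<rbrakk> \<Longrightarrow> \<phi> n c t \<omega> \<in> {0..d_max}"
    and Q_nonneg: "\<lbrakk>n \<in> N; c \<in> C; n \<noteq> dest c; \<omega> \<in> space M\<rbrakk> \<Longrightarrow> 0 \<le> Q n c t \<omega>"
    and Q_0: "\<lbrakk>n \<in> N; c \<in> C; n \<noteq> dest c; \<omega> \<in> space M\<rbrakk> \<Longrightarrow> Q n c 0 \<omega> = 0"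
    and Q_Suc: "\<lbrakk>n \<in> N; c \<in> C; n \<noteq> dest c; \<omega> \<in> space M\<rbrakk> \<Longrightarrow>
          Q n c (Suc t) \<omega> \<le>
            max (max (Q n c t \<omega> - (\<Sum>b\<in>out_nbrs n. \<mu> n b c t \<omega>)) 0 - d n c t \<omega>) 0
            + real (A n c t \<omega>) + (\<Sum>a\<in>in_nbrs n. \<mu> a n c t \<omega>)"
    and D_0: "\<lbrakk>n \<in> N; c \<in> C; n \<noteq> dest c; \<omega> \<in> space M\<rbrakk> \<Longrightarrow> D n c 0 \<omega> = V * \<theta> c"
    and D_Suc: "\<lbrakk>n \<in> N; c \<in> C; n \<noteq> dest c; \<omega> \<in> space M\<rbrakk> \<Longrightarrow>
          D n c (Suc t) \<omega> =
            max (D n c t \<omega> - \<phi> n c t \<omega>) 0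
            + min (max (Q n c t \<omega> - (\<Sum>b\<in>out_nbrs n. \<mu> n b c t \<omega>)) 0) (d n c t \<omega>)"
    and Z_0: "\<lbrakk>c \<in> C; \<omega> \<in> space M\<rbrakk> \<Longrightarrow> Z c 0 \<omega> = 0"
    and Z_Suc: "\<lbrakk>c \<in> C; \<omega> \<in> space M\<rbrakk> \<Longrightarrow>
          Z c (Suc t) \<omega> =
            max (Z c t \<omega> - \<nu> c t \<omega>) 0
            + (\<Sum>a\<in>in_nbrs (dest c) - {dest c}. min (Q a c t \<omega>) (\<mu> a (dest c) c t \<omega>))"
begin

definition dest_weight :: "real \<Rightarrow> real \<Rightarrow> 'c \<Rightarrow> nat \<Rightarrow> 'w \<Rightarrow> real" where
  "dest_weight w Q_ref c t \<omega> =
     (if Z c t \<omega> \<ge> Q_ref then w * exp (w * (Z c t \<omega> - Q_ref))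
      else - w * exp (w * (Q_ref - Z c t \<omega>)))"

definition backlog :: "real \<Rightarrow> real \<Rightarrow> 'n \<Rightarrow> 'c \<Rightarrow> nat \<Rightarrow> 'w \<Rightarrow> real" where
  "backlog w Q_ref n c t \<omega> = (if n = dest c then dest_weight w Q_ref c t \<omega> else Q n c t \<omega>)"

definition link_weight :: "real \<Rightarrow> real \<Rightarrow> 'n \<Rightarrow> 'n \<Rightarrow> 'c \<Rightarrow> nat \<Rightarrow> 'w \<Rightarrow> real" where
  "link_weight w Q_ref n m c t \<omega> = backlog w Q_ref n c t \<omega> - backlog w Q_ref m c t \<omega>"

end

text \<open>\<open>Q_ref\<close> is the constant \<open>Q\<close> of the virtual destination backlog, \<open>acc n m\<close> the set of classes
  with access to the link \<open>(n, m)\<close> and \<open>cstar n m t \<omega>\<close> an arbitrary (possibly randomised) selection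
  of a weight-maximising class, meaningful only if \<open>acc n m\<close> is nonempty.\<close>

locale uora = queueing_network N L C dest cap M A A_max lam d_max V \<theta> \<mu> d \<phi> \<nu> Q D Z
  for N :: "'n set" and L :: "('n \<times> 'n) set" and C :: "'c set"
    and dest :: "'c \<Rightarrow> 'n" and cap :: "'n \<Rightarrow> 'n \<Rightarrow> real"
    and M :: "'w measure" and A :: "'n \<Rightarrow> 'c \<Rightarrow> nat \<Rightarrow> 'w \<Rightarrow> nat" and A_max :: nat
    and lam :: "'n \<Rightarrow> 'c \<Rightarrow> real"
    and d_max V :: real and \<theta> :: "'c \<Rightarrow> real"
    and \<mu> :: "'n \<Rightarrow> 'n \<Rightarrow> 'c \<Rightarrow> nat \<Rightarrow> 'w \<Rightarrow> real"
    and d \<phi> :: "'n \<Rightarrow> 'c \<Rightarrow> nat \<Rightarrow> 'w \<Rightarrow> real"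
    and \<nu> :: "'c \<Rightarrow> nat \<Rightarrow> 'w \<Rightarrow> real"
    and Q D :: "'n \<Rightarrow> 'c \<Rightarrow> nat \<Rightarrow> 'w \<Rightarrow> real"
    and Z :: "'c \<Rightarrow> nat \<Rightarrow> 'w \<Rightarrow> real" +
  fixes g :: "'c \<Rightarrow> real \<Rightarrow> real" and \<epsilon> \<nu>_max Q_ref :: real
    and r_star :: "'c \<Rightarrow> real"
    and acc :: "'n \<Rightarrow> 'n \<Rightarrow> 'c set"
    and cstar :: "'n \<Rightarrow> 'n \<Rightarrow> nat \<Rightarrow> 'w \<Rightarrow> 'c"
  assumes g_concave: "c \<in> C \<Longrightarrow> concave_on {0..} (g c)"
    and g_mono: "c \<in> C \<Longrightarrow> mono_on {0..} (g c)"
    and g_C1: "c \<in> C \<Longrightarrow> \<exists>g'. (\<forall>x\<ge>0. (g c has_real_derivative g' x) (at x within {0..}))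
          \<and> continuous_on {0..} g' \<and> bounded (g' ` {0..})"
    and eps_pos: "0 < \<epsilon>"
    and r_star_opt: "is_arg_max (\<lambda>r. \<Sum>c\<in>C. g c (r c)) (\<lambda>r. r \<in> feasible_rates lam) r_star"
    and nu_max_ge: "Max (r_star ` C) + \<epsilon> / 2 \<le> \<nu>_max"
    and Q_ref_ge: "\<nu>_max \<le> Q_ref"
    and theta_pos: "c \<in> C \<Longrightarrow> 0 < \<theta> c"
    and theta_deriv: "\<lbrakk>c \<in> C; \<epsilon> \<le> x\<rbrakk> \<Longrightarrow> deriv (\<lambda>y. g c y - \<theta> c * y) x \<le> 0"
    and V_pos: "0 < V"
    and V_theta: "c \<in> C \<Longrightarrow> w_param \<epsilon> \<nu>_max \<le> V * \<theta> c + 2 * d_max"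
    and acc_sub: "(n, m) \<in> L \<Longrightarrow> acc n m \<subseteq> C"
    and acc_dest: "\<lbrakk>(n, m) \<in> L; c \<in> acc n m\<rbrakk> \<Longrightarrow> n \<noteq> dest c"
    and drop_policy: "\<lbrakk>n \<in> N; c \<in> C; n \<noteq> dest c; \<omega> \<in> space M\<rbrakk> \<Longrightarrow>
          d n c t \<omega> = (if Q n c t \<omega> > D n c t \<omega> then d_max else 0)"
    and phi_policy: "\<lbrakk>n \<in> N; c \<in> C; n \<noteq> dest c; \<omega> \<in> space M\<rbrakk> \<Longrightarrow>
          \<phi> n c t \<omega> = (if D n c t \<omega> > V * \<theta> c then d_max else 0)"
    and cstar_max: "\<lbrakk>(n, m) \<in> L; acc n m \<noteq> {}; \<omega> \<in> space M\<rbrakk> \<Longrightarrow>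
          is_arg_max (\<lambda>c. link_weight (w_param \<epsilon> \<nu>_max) Q_ref n m c t \<omega>)
            (\<lambda>c. c \<in> acc n m) (cstar n m t \<omega>)"
    and routing_policy: "\<lbrakk>(n, m) \<in> L; c \<in> C; \<omega> \<in> space M\<rbrakk> \<Longrightarrow>
          \<mu> n m c t \<omega> =
            (if acc n m \<noteq> {} \<and> c = cstar n m t \<omega> \<and>
                Max ((\<lambda>c'. link_weight (w_param \<epsilon> \<nu>_max) Q_ref n m c' t \<omega>) ` acc n m) > 0
             then cap n m else 0)"
    and flow_control: "\<lbrakk>c \<in> C; \<omega> \<in> space M\<rbrakk> \<Longrightarrow>
          is_arg_max (\<lambda>x. V * (g c x - \<theta> c * x) + x * dest_weight (w_param \<epsilon> \<nu>_max) Q_ref c t \<omega>)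
            (\<lambda>x. x \<in> {0..\<nu>_max}) (\<nu> c t \<omega>)"

end

theory Submission
  imports Defs
begin

text \<open>
  Every queue has a switch: as soon as the queue exceeds a nonnegative threshold, its input stops
  or its service rate is at least the largest possible input. From then on a slot either does not
  increase the queue, or empties it and leaves one slot's input. Such a queue, not started above
  the threshold, is bounded by the threshold plus the largest input in a single slot. All
  arguments are on a fixed sample path.

  A drop queue is served at rate \<open>d_max\<close> above the threshold \<open>V * \<theta> c\<close>, and receives
  at most \<open>d_max\<close> per slot, hence never exceeds \<open>V * \<theta> c + d_max\<close>
  (\<open>drop_queue_le\<close>). A data queue drops at rate \<open>d_max\<close> once it exceeds its drop
  queue, thus in particular above \<open>V * \<theta> c + d_max\<close>; its input per slot is at most
  \<open>A_max + mu_max_in \<le> d_max\<close>, so it never exceeds \<open>V * \<theta> c + 2 * d_max\<close>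
  (\<open>data_queue_le\<close>). For the virtual queue the switch is backpressure: the level
  \<open>Q_ref + ln ((V * \<theta> c + 2 * d_max) / w) / w\<close> is precisely where the exponential
  destination weight equals the bound on the data queues. Above it every link into the destination
  has negative weight for that class and delivers nothing (\<open>no_delivery_above_data_bound\<close>);
  below it one slot adds at most \<open>mu_max_in\<close> (\<open>virtual_queue_le\<close>).
\<close>

context network
begin

lemma finite_in_nbrs: "finite (in_nbrs n)"
  using finite_subset[OF _ finite_N, of "in_nbrs n"] L_sub by (auto simp: in_nbrs_def)

lemma sum_cap_le_mu_max_in: "n \<in> N \<Longrightarrow> (\<Sum>a\<in>in_nbrs n. cap a n) \<le> mu_max_in"
  unfolding mu_max_in_def using finite_N by (intro Max_ge) auto

lemma mu_max_in_nonneg: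
  assumes "n \<in> N"
  shows "0 \<le> mu_max_in"
proof -
  have "0 \<le> (\<Sum>a\<in>in_nbrs n. cap a n)"
    by (intro sum_nonneg) (auto simp: in_nbrs_def cap_nonneg)
  also have "\<dots> \<le> mu_max_in"
    by (rule sum_cap_le_mu_max_in[OF assms])
  finally show ?thesis .
qed

end

context queueing_network
begin

lemma mu_le_cap:
  assumes "(n, m) \<in> L" "c \<in> C" "\<omega> \<in> space M"
  shows "\<mu> n m c t \<omega> \<le> cap n m"
proof -
  have "\<mu> n m c t \<omega> \<le> (\<Sum>c\<in>C. \<mu> n m c t \<omega>)"
    using assms finite_C mu_nonneg by (intro member_le_sum) auto
  also have "\<dots> \<le> cap n m"
    using assms mu_cap by blast
  finally show ?thesis .
qed

lemma sum_mu_in_le_mu_max_in: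
  assumes "n \<in> N" "c \<in> C" "\<omega> \<in> space M"
  shows "(\<Sum>a\<in>in_nbrs n. \<mu> a n c t \<omega>) \<le> mu_max_in"
proof -
  have "(\<Sum>a\<in>in_nbrs n. \<mu> a n c t \<omega>) \<le> (\<Sum>a\<in>in_nbrs n. cap a n)"
    using assms by (intro sum_mono mu_le_cap) (auto simp: in_nbrs_def)
  also have "\<dots> \<le> mu_max_in"
    by (rule sum_cap_le_mu_max_in[OF assms(1)])
  finally show ?thesis .
qed

lemma delivered_le_mu_max_in:
  assumes "c \<in> C" "\<omega> \<in> space M"
  shows "(\<Sum>a\<in>in_nbrs (dest c) - {dest c}. min (Q a c t \<omega>) (\<mu> a (dest c) c t \<omega>)) \<le> mu_max_in"
proof -
  have "(\<Sum>a\<in>in_nbrs (dest c) - {dest c}. min (Q a c t \<omega>) (\<mu> a (dest c) c t \<omega>))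
      \<le> (\<Sum>a\<in>in_nbrs (dest c) - {dest c}. \<mu> a (dest c) c t \<omega>)"
    by (intro sum_mono) simp
  also have "\<dots> \<le> (\<Sum>a\<in>in_nbrs (dest c). \<mu> a (dest c) c t \<omega>)"
    using assms mu_nonneg by (intro sum_mono2 finite_in_nbrs) (auto simp: in_nbrs_def)
  also have "\<dots> \<le> mu_max_in"
    using assms by (intro sum_mu_in_le_mu_max_in dest_N)
  finally show ?thesis .
qed

lemma d_max_nonneg: "n \<in> N \<Longrightarrow> 0 \<le> d_max"
  using d_max_ge mu_max_in_nonneg[of n] by linarith

text \<open>The arrivals and the link input of one slot together fit into a single slot of dropping
  at rate \<open>d_max\<close>; this is where \<open>A_max + mu_max_in \<le> d_max\<close> enters.\<close>

lemma data_queue_step: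
  assumes "n \<in> N" "c \<in> C" "n \<noteq> dest c" "\<omega> \<in> space M"
  shows "Q n c (Suc t) \<omega> \<le> max (Q n c t \<omega> - d n c t \<omega>) 0 + d_max"
proof -
  have "0 \<le> (\<Sum>b\<in>out_nbrs n. \<mu> n b c t \<omega>)"
    using assms by (intro sum_nonneg mu_nonneg) (auto simp: out_nbrs_def)
  moreover have "real (A n c t \<omega>) \<le> real A_max"
    using A_bound assms by simp
  moreover have "0 \<le> d n c t \<omega>"
    using d_range[OF assms] by simp
  ultimately show ?thesis
    using Q_Suc[OF assms, of t] sum_mu_in_le_mu_max_in[OF assms(1,2,4), of t] d_max_ge by linarith
qed

end

context uora
begin

text \<open>The optimal rates are nonnegative, so \<open>\<epsilon> / 2\<close> is a lower bound on \<open>\<nu>_max\<close>.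
  A class \<open>c\<close> must exist because the maximum of the rates over an empty \<open>C\<close> is
  unspecified.\<close>

lemma nu_max_pos:
  assumes "c \<in> C"
  shows "0 < \<nu>_max"
proof -
  have "0 \<le> r_star c"
    using r_star_opt assms by (auto simp: is_arg_max_def feasible_rates_def)
  also have "\<dots> \<le> Max (r_star ` C)"
    using assms finite_C by simp
  finally show ?thesis
    using nu_max_ge eps_pos by linarith
qed

lemma w_param_pos:
  assumes "c \<in> C"
  shows "0 < w_param \<epsilon> \<nu>_max"
proof -
  have "0 < delta_max \<nu>_max"
    using nu_max_pos[OF assms] by (simp add: delta_max_def)
  then show ?thesis
    using eps_pos by (simp add: w_param_def)
qed

text \<open>Above \<open>V * \<theta> c\<close> the drop queue is served at rate \<open>d_max\<close>. The packets dropped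
  in the same slot only make up for this service, or number at most \<open>d_max\<close> if the service
  empties the queue.\<close>

lemma drop_queue_le:
  assumes "n \<in> N" "c \<in> C" "n \<noteq> dest c" "\<omega> \<in> space M"
  shows "D n c t \<omega> \<le> V * \<theta> c + d_max"
proof (induction t)
  case 0
  show ?case
    using D_0[OF assms] d_max_nonneg[OF assms(1)] by simp
next
  case (Suc t)
  have "0 < V * \<theta> c"
    using V_pos theta_pos assms(2) by simp
  moreover have "D n c (Suc t) \<omega> \<le> max (D n c t \<omega> - \<phi> n c t \<omega>) 0 + d_max"
    using D_Suc[OF assms, of t] d_range[OF assms, of t] by auto
  ultimately show ?case
    using Suc phi_policy[OF assms, of t] by (cases "D n c t \<omega> > V * \<theta> c") auto
qed

text \<open>The drop queue is itself the threshold at which dropping starts, so its bound turns into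
  one for the data queue: either the queue drops at rate \<open>d_max\<close>, which pays for the slot's
  input unless it empties the queue, or the queue is at most \<open>V * \<theta> c + d_max\<close> and gains
  at most \<open>d_max\<close>.\<close>

lemma data_queue_le:
  assumes "n \<in> N" "c \<in> C" "n \<noteq> dest c" "\<omega> \<in> space M"
  shows "Q n c t \<omega> \<le> V * \<theta> c + 2 * d_max"
proof (induction t)
  case 0
  have "0 < V * \<theta> c"
    using V_pos theta_pos assms(2) by simp
  then show ?case
    using Q_0[OF assms] d_max_nonneg[OF assms(1)] by simp
next
  case (Suc t)
  have "0 < V * \<theta> c"
    using V_pos theta_pos assms(2) by simp
  then show ?case
    using Suc data_queue_step[OF assms, of t] drop_policy[OF assms, of t]
      drop_queue_le[OF assms, of t] d_max_nonneg[OF assms(1)]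
    by (cases "Q n c t \<omega> > D n c t \<omega>") auto
qed

text \<open>A link serves only a class that maximises its weight, and only if that maximum is
  positive; so the class that is served has a positive weight itself.\<close>

lemma served_imp_link_weight_pos:
  assumes "(n, m) \<in> L" "c \<in> C" "\<omega> \<in> space M" "\<mu> n m c t \<omega> \<noteq> 0"
  shows "link_weight (w_param \<epsilon> \<nu>_max) Q_ref n m c t \<omega> > 0"
proof -
  let ?W = "\<lambda>c. link_weight (w_param \<epsilon> \<nu>_max) Q_ref n m c t \<omega>"
  have acc: "acc n m \<noteq> {}" and c: "c = cstar n m t \<omega>" and pos: "Max (?W ` acc n m) > 0"
    using assms routing_policy[OF assms(1-3), of t] by (auto split: if_splits)
  have "finite (acc n m)"
    using acc_sub[OF assms(1)] finite_C finite_subset by blast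
  then have "Max (?W ` acc n m) \<in> ?W ` acc n m"
    using acc by (intro Max_in) auto
  then obtain c' where "c' \<in> acc n m" "?W c' > 0"
    using pos by auto
  then show ?thesis
    using cstar_max[OF assms(1) acc assms(3), of t] c
    by (force simp: is_arg_max_def)
qed

text \<open>Backpressure sees a destination weight at least as large as every data queue of the
  class, so no link into the destination has a positive weight for it.\<close>

lemma no_delivery_above_data_bound:
  assumes "c \<in> C" "\<omega> \<in> space M"
    and "V * \<theta> c + 2 * d_max \<le> dest_weight (w_param \<epsilon> \<nu>_max) Q_ref c t \<omega>"
  shows "(\<Sum>a\<in>in_nbrs (dest c) - {dest c}. min (Q a c t \<omega>) (\<mu> a (dest c) c t \<omega>)) \<le> 0"
proof (intro sum_nonpos)
  fix a
  assume a: "a \<in> in_nbrs (dest c) - {dest c}"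
  then have link: "(a, dest c) \<in> L" "a \<in> N" "a \<noteq> dest c"
    using L_sub by (auto simp: in_nbrs_def)
  have "link_weight (w_param \<epsilon> \<nu>_max) Q_ref a (dest c) c t \<omega> \<le> 0"
    using data_queue_le[OF link(2) assms(1) link(3) assms(2), of t] assms(3) link(3)
    by (simp add: link_weight_def backlog_def)
  then have "\<mu> a (dest c) c t \<omega> = 0"
    using served_imp_link_weight_pos[OF link(1) assms(1,2), of t] by fastforce
  then show "min (Q a c t \<omega>) (\<mu> a (dest c) c t \<omega>) \<le> 0"
    by simp
qed

text \<open>The bound has this form because the destination weight is exponential above
  \<open>Q_ref\<close>: solving \<open>w * exp (w * (B - Q_ref)) = V * \<theta> c + 2 * d_max\<close> for \<open>B\<close>
  gives the level at which deliveries stop, and one slot can overshoot it by \<open>mu_max_in\<close>.\<close>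

lemma virtual_queue_le:
  assumes "c \<in> C" "\<omega> \<in> space M"
  defines "w \<equiv> w_param \<epsilon> \<nu>_max"
  shows "Z c t \<omega> \<le> Q_ref + 1 / w * ln ((V * \<theta> c + 2 * d_max) / w) + mu_max_in"
proof -
  define x where "x = V * \<theta> c + 2 * d_max"
  define B where "B = Q_ref + 1 / w * ln (x / w)"
  have w: "0 < w" "w \<le> x"
    using w_param_pos[OF assms(1)] V_theta[OF assms(1)] by (auto simp: w_def x_def)
  \<comment> \<open>As \<open>w \<le> x\<close>, the level \<open>B\<close> is on the branch above \<open>Q_ref\<close> of the
    destination weight, and the initial value \<open>0\<close> of \<open>Z\<close> is below it.\<close>
  have ln_nonneg: "0 \<le> 1 / w * ln (x / w)"
    using w by simp
  then have B: "0 \<le> B" "Q_ref \<le> B"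
    using nu_max_pos[OF assms(1)] Q_ref_ge by (auto simp: B_def)
  have mu: "0 \<le> mu_max_in"
    using mu_max_in_nonneg dest_N[OF assms(1)] by blast
  have "Z c t \<omega> \<le> B + mu_max_in"
  proof (induction t)
    case 0
    show ?case
      using Z_0[OF assms(1,2)] B(1) mu by simp
  next
    case (Suc t)
    let ?in = "\<Sum>a\<in>in_nbrs (dest c) - {dest c}. min (Q a c t \<omega>) (\<mu> a (dest c) c t \<omega>)"
    have "0 \<le> \<nu> c t \<omega>"
      using flow_control[OF assms(1,2), of t] by (auto simp: is_arg_max_def)
    then have step: "Z c (Suc t) \<omega> \<le> max (Z c t \<omega>) 0 + ?in"
      using Z_Suc[OF assms(1,2), of t] by linarith
    show ?case
    proof (cases "Z c t \<omega> \<le> B")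
      case True
      then show ?thesis
        using step B(1) delivered_le_mu_max_in[OF assms(1,2), of t] by linarith
    next
      case False
      have "x = w * exp (w * (B - Q_ref))"
        using w by (simp add: B_def)
      also have "\<dots> \<le> w * exp (w * (Z c t \<omega> - Q_ref))"
        using w False by simp
      also have "\<dots> = dest_weight w Q_ref c t \<omega>"
        using False B(2) by (simp add: dest_weight_def)
      finally have "?in \<le> 0"
        using no_delivery_above_data_bound[OF assms(1,2)] by (simp add: w_def x_def)
      then show ?thesis
        using step Suc B(1) mu by linarith
    qed
  qed
  then show ?thesis
    by (simp add: B_def x_def)
qed

end

theorem lemma3:
  fixes N :: "'n set" and L :: "('n \<times> 'n) set" and C :: "'c set"
    and dest :: "'c \<Rightarrow> 'n" and cap :: "'n \<Rightarrow> 'n \<Rightarrow> real"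
    and M :: "'w measure" and A :: "'n \<Rightarrow> 'c \<Rightarrow> nat \<Rightarrow> 'w \<Rightarrow> nat" and A_max :: nat
    and lam :: "'n \<Rightarrow> 'c \<Rightarrow> real"
    and d_max V :: real and \<theta> :: "'c \<Rightarrow> real"
    and \<mu> :: "'n \<Rightarrow> 'n \<Rightarrow> 'c \<Rightarrow> nat \<Rightarrow> 'w \<Rightarrow> real"
    and d \<phi> :: "'n \<Rightarrow> 'c \<Rightarrow> nat \<Rightarrow> 'w \<Rightarrow> real"
    and \<nu> :: "'c \<Rightarrow> nat \<Rightarrow> 'w \<Rightarrow> real"
    and Q D :: "'n \<Rightarrow> 'c \<Rightarrow> nat \<Rightarrow> 'w \<Rightarrow> real"
    and Z :: "'c \<Rightarrow> nat \<Rightarrow> 'w \<Rightarrow> real"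
    and g :: "'c \<Rightarrow> real \<Rightarrow> real" and \<epsilon> \<nu>_max Q_ref w :: real
    and r_star :: "'c \<Rightarrow> real"
    and acc :: "'n \<Rightarrow> 'n \<Rightarrow> 'c set"
    and cstar :: "'n \<Rightarrow> 'n \<Rightarrow> nat \<Rightarrow> 'w \<Rightarrow> 'c"
  assumes "uora N L C dest cap M A A_max lam d_max V \<theta> \<mu> d \<phi> \<nu> Q D Z
             g \<epsilon> \<nu>_max Q_ref r_star acc cstar"
    and "w = network.w_param N L cap \<epsilon> \<nu>_max"
  shows "\<forall>\<omega>\<in>space M. \<forall>t. \<forall>c\<in>C.
           (\<forall>n\<in>N - {dest c}.
              Q n c t \<omega> \<le> V * \<theta> c + 2 * d_max \<and>
              D n c t \<omega> \<le> V * \<theta> c + d_max) \<and>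
           Z c t \<omega> \<le> Q_ref + 1 / w * ln ((V * \<theta> c + 2 * d_max) / w)
                       + network.mu_max_in N L cap"
proof -
  interpret uora N L C dest cap M A A_max lam d_max V \<theta> \<mu> d \<phi> \<nu> Q D Z
      g \<epsilon> \<nu>_max Q_ref r_star acc cstar
    by (rule assms(1))
  show ?thesis
    using drop_queue_le data_queue_le virtual_queue_le unfolding assms(2) by auto
qed

end
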